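(* Let $k > 1$ be a fixed integer, and let $\alpha \in \left[0, \tfrac{1}{k-1}\right) \cap \mathbb{Q}$ and $\beta \in [0,1] \cap \mathbb{Q}$ be fixed rational numbers satisfying $\beta + (k-1)\alpha = 1$. Then there exists a sequence $\{G_n\}_{n=1}^{\infty}$ of pairwise non-homomorphically equivalent graphs (that is, $G_i$ and $G_j$ are not homomorphically equivalent whenever $i \neq j$), each being a regular graph of positive degree, such that each $G_n$ admits a FAT $k$-coloring with the corresponding parameters $\alpha$ and $\beta$.
   Context: All graphs are simple, with finite nonempty vertex sets. For a vertex $v$ of a graph $G$, $N(v)$ denotes the set of vertices adjacent to $v$, and $\deg(v) = |N(v)|$. A graph is regular if all its vertices have the same degree. FAT $k$-coloring: let $C$ be a color set of cardinality $k$ and let $c \colon V(G) \to C$ be a (not necessarily proper) vertex coloring whose color classes (the preimages of the individual colors) are $V_1, V_2, \dots, V_k$, each of which is nonempty. The coloring $c$ is a FAT (Fair And Tolerant) $k$-coloring of $G$ with corresponding parameters $\alpha, \beta \in [0,1]$ if for every vertex $v \in V(G)$ and every color class $V_i$, $$ \bigl| V_i \cap N(v) \bigr| = \begin{cases} \alpha \deg(v) & \mbox{if } v \notin V_i, \\ \beta \deg(v) & \mbox{if } v \in V_i. \end{cases} $$ A homomorphism from a graph $G$ to a graph $H$ is a mapping $f \colon V(G) \to V(H)$ such that $xy \in E(G)$ implies $f(x)f(y) \in E(H)$ for every pair of vertices $x, y$ of $G$. Two graphs $G$ and $H$ are homomorphically equivalent if there exist both a homomorphism from $G$ to $H$ and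 a homomorphism from $H$ to $G$. *)

theory Defs
  imports Complex_Main "Graph_Theory.Pair_Digraph"
begin

text \<open>
  An undirected graph is a symmetric digraph whose arcs are ordered pairs of vertices: the edge
  \<open>uv\<close> is the pair of arcs \<open>(u, v)\<close>, \<open>(v, u)\<close>. The library locale \<^locale>\<open>pair_graph\<close> gives finiteness,
  symmetry and the absence of loops, but it admits the graph without vertices.
\<close>

definition simple_graph :: "'a pair_pre_digraph \<Rightarrow> bool" where
  "simple_graph G \<longleftrightarrow> pair_graph G \<and> pverts G \<noteq> {}"

definition nbhd :: "'a pair_pre_digraph \<Rightarrow> 'a \<Rightarrow> 'a set" where
  "nbhd G v = {u \<in> pverts G. (v, u) \<in> parcs G}"

definition deg :: "'a pair_pre_digraph \<Rightarrow> 'a \<Rightarrow> nat" where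
  "deg G v = card (nbhd G v)"

definition regular_graph :: "'a pair_pre_digraph \<Rightarrow> bool" where
  "regular_graph G \<longleftrightarrow> (\<forall>u \<in> pverts G. \<forall>v \<in> pverts G. deg G u = deg G v)"

definition color_class :: "'a pair_pre_digraph \<Rightarrow> ('a \<Rightarrow> 'c) \<Rightarrow> 'c \<Rightarrow> 'a set" where
  "color_class G c i = {v \<in> pverts G. c v = i}"

definition FAT_coloring ::
  "'a pair_pre_digraph \<Rightarrow> nat \<Rightarrow> real \<Rightarrow> real \<Rightarrow> 'c set \<Rightarrow> ('a \<Rightarrow> 'c) \<Rightarrow> bool" where
  "FAT_coloring G k \<alpha> \<beta> C c \<longleftrightarrow>
     finite C \<and> card C = k \<and> c ` pverts G \<subseteq> C \<and>
     (\<forall>i \<in> C. color_class G c i \<noteq> {}) \<and>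
     \<alpha> \<in> {0..1} \<and> \<beta> \<in> {0..1} \<and>
     (\<forall>v \<in> pverts G. \<forall>i \<in> C.
        real (card (color_class G c i \<inter> nbhd G v)) =
          (if v \<in> color_class G c i then \<beta> * real (deg G v) else \<alpha> * real (deg G v)))"

text \<open>
  The names of the colors are irrelevant, and every finite color set is in bijection with a set
  of natural numbers, so it suffices to quantify over the latter.
\<close>

definition admits_FAT_coloring ::
  "'a pair_pre_digraph \<Rightarrow> nat \<Rightarrow> real \<Rightarrow> real \<Rightarrow> bool" where
  "admits_FAT_coloring G k \<alpha> \<beta> \<longleftrightarrow> (\<exists>(C :: nat set) c. FAT_coloring G k \<alpha> \<beta> C c)"

definition graph_hom ::
  "'a pair_pre_digraph \<Rightarrow> 'b pair_pre_digraph \<Rightarrow> ('a \<Rightarrow> 'b) \<Rightarrow> bool" where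
  "graph_hom G H f \<longleftrightarrow>
     f ` pverts G \<subseteq> pverts H \<and>
     (\<forall>x \<in> pverts G. \<forall>y \<in> pverts G. (x, y) \<in> parcs G \<longrightarrow> (f x, f y) \<in> parcs H)"

definition hom_equivalent :: "'a pair_pre_digraph \<Rightarrow> 'b pair_pre_digraph \<Rightarrow> bool" where
  "hom_equivalent G H \<longleftrightarrow> (\<exists>f. graph_hom G H f) \<and> (\<exists>g. graph_hom H G g)"

end

theory Submission
  imports Defs
begin

text \<open>
  Write \<open>\<alpha> = a / d\<close> and \<open>\<beta> = b / d\<close> with \<open>d = b + (k - 1) a\<close>; here \<open>b \<ge> 1\<close> because
  \<open>\<alpha> < 1 / (k - 1)\<close>. If every vertex has exactly \<open>b t\<close> neighbours in its own class and \<open>a t\<close> in each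
  other class, the coloring is FAT and the degree is \<open>d t\<close>. Such a graph exists in which each class
  is a disjoint union of cliques on \<open>b t + 1\<close> vertices. A clique in the graph with parameter \<open>t\<close> has
  at most \<open>d t + 1\<close> vertices, so a graph whose parameter is more than \<open>d\<close> times as large does not
  map to it; hence \<open>t = (d + 1) ^ n\<close> gives a sequence as required.
\<close>

text \<open>Since \<open>H\<close> has no loops, \<open>f\<close> cannot identify two adjacent
  vertices, so it is injective on a clique; the images of the other clique vertices are neighbours
  of \<open>f v\<close>.\<close>

lemma clique_card_le_deg:
  assumes f: "graph_hom G H f" and H: "pair_graph H"
    and K: "finite K" "K \<subseteq> pverts G" "\<And>x y. x \<in> K \<Longrightarrow> y \<in> K \<Longrightarrow> x \<noteq> y \<Longrightarrow> (x, y) \<in> parcs G"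
    and v: "v \<in> K"
  shows "card K \<le> Suc (deg H (f v))"
proof -
  interpret H: pair_graph H by (rule H)
  have arc: "(f x, f y) \<in> parcs H" if "x \<in> K" "y \<in> K" "x \<noteq> y" for x y
    using f K(2) K(3)[OF that] that unfolding graph_hom_def by blast
  have inj: "inj_on f K"
    using arc H.no_loops' unfolding inj_on_def by blast
  have "f ` (K - {v}) \<subseteq> nbhd H (f v)"
    using arc v H.in_arcsD2 unfolding nbhd_def by blast
  moreover have "finite (nbhd H (f v))"
    by (simp add: nbhd_def)
  ultimately have "card (f ` (K - {v})) \<le> deg H (f v)"
    unfolding deg_def by (rule card_mono[rotated])
  then show ?thesis
    using inj K v by (simp add: card_image inj_on_diff)
qed

lemma deg_eq_sum_color_classes:
  assumes "pair_graph G" "finite C" "c ` pverts G \<subseteq> C"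
  shows "deg G v = (\<Sum>i\<in>C. card (color_class G c i \<inter> nbhd G v))"
proof -
  interpret pair_graph G by fact
  have "nbhd G v = (\<Union>i\<in>C. color_class G c i \<inter> nbhd G v)"
    using assms(3) by (auto simp: nbhd_def color_class_def)
  moreover have "card (\<Union>i\<in>C. color_class G c i \<inter> nbhd G v)
      = (\<Sum>i\<in>C. card (color_class G c i \<inter> nbhd G v))"
    by (rule card_UN_disjoint) (use assms(2) in \<open>auto simp: nbhd_def color_class_def\<close>)
  ultimately show ?thesis
    by (simp add: deg_def)
qed

text \<open>The graphs are described on triples; this injective coding moves them to
  \<open>nat\<close>, so that the whole sequence has one vertex type.\<close>

definition enc :: "nat \<times> nat \<times> nat \<Rightarrow> nat" where
  "enc t = prod_encode (fst t, prod_encode (snd t))"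

lemma enc_eq_iff [simp]: "enc s = enc t \<longleftrightarrow> s = t"
  by (auto simp: enc_def prod_eq_iff)

lemma card_enc_image [simp]: "card (enc ` A) = card A"
  by (simp add: card_image inj_on_def)

definition color :: "nat \<Rightarrow> nat" where
  "color v = fst (prod_decode v)"

lemma color_enc [simp]: "color (enc (i, x, y)) = i"
  by (simp add: color_def enc_def)

text \<open>
  A vertex \<open>(i, x, y)\<close> has color \<open>i\<close>. The third coordinate ranges over \<open>max 1 r\<close> values, not \<open>r\<close>,
  so that there are vertices when \<open>r = 0\<close> (the case \<open>\<alpha> = 0\<close>); the condition \<open>r > 0\<close> then removes
  the edges between different classes.
\<close>

definition grid_vertices :: "nat \<Rightarrow> nat \<Rightarrow> nat \<Rightarrow> (nat \<times> nat \<times> nat) set" where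
  "grid_vertices k s r = {..<k} \<times> {..s} \<times> {..<max 1 r}"

text \<open>For \<open>r > 0\<close>, each class is a union of \<open>r\<close> disjoint cliques on
  \<open>s + 1\<close> vertices, one for each \<open>y\<close>, and between two classes there is a
  disjoint union of complete bipartite graphs K_{r,r}, one for each \<open>x\<close>.\<close>

fun grid_adj :: "nat \<Rightarrow> nat \<times> nat \<times> nat \<Rightarrow> nat \<times> nat \<times> nat \<Rightarrow> bool" where
  "grid_adj r (i, x, y) (j, x', y') \<longleftrightarrow>
     (if i = j then x \<noteq> x' \<and> y = y' else x = x' \<and> r > 0)"

lemma grid_adj_sym: "grid_adj r u v \<Longrightarrow> grid_adj r v u"
  by (cases u; cases v) (auto split: if_splits)

lemma grid_adj_irrefl [simp]: "\<not> grid_adj r u u"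
  by (cases u) simp

definition grid_graph :: "nat \<Rightarrow> nat \<Rightarrow> nat \<Rightarrow> nat pair_pre_digraph" where
  "grid_graph k s r = \<lparr>pverts = enc ` grid_vertices k s r,
     parcs = {(enc u, enc v) | u v.
       u \<in> grid_vertices k s r \<and> v \<in> grid_vertices k s r \<and> grid_adj r u v}\<rparr>"

lemma pverts_grid_graph [simp]: "pverts (grid_graph k s r) = enc ` grid_vertices k s r"
  by (simp add: grid_graph_def)

lemma parcs_grid_graph [simp]:
  "(enc u, enc v) \<in> parcs (grid_graph k s r) \<longleftrightarrow>
     u \<in> grid_vertices k s r \<and> v \<in> grid_vertices k s r \<and> grid_adj r u v"
  by (auto simp: grid_graph_def simp del: split_paired_Ex grid_adj.simps)

lemma finite_grid_vertices [simp]: "finite (grid_vertices k s r)"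
  by (simp add: grid_vertices_def)

lemma pair_graph_grid_graph: "pair_graph (grid_graph k s r)"
proof
  show "finite (parcs (grid_graph k s r))"
    by (rule finite_subset[of _ "enc ` grid_vertices k s r \<times> enc ` grid_vertices k s r"])
      (auto simp: grid_graph_def)
  show "symmetric (with_proj (grid_graph k s r))"
    unfolding symmetric_def sym_def arcs_ends_def
    by (simp add: arc_to_ends_def grid_graph_def image_def del: grid_adj.simps)
      (use grid_adj_sym in blast)
qed (auto simp: grid_graph_def simp del: grid_adj.simps)

lemma simple_graph_grid_graph:
  assumes "k > 0"
  shows "simple_graph (grid_graph k s r)"
proof -
  have "(0, 0, 0) \<in> grid_vertices k s r"
    using assms by (simp add: grid_vertices_def)
  then show ?thesis
    by (auto simp: simple_graph_def pair_graph_grid_graph)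
qed

lemma card_color_class_nbhd_grid_graph:
  assumes v: "v \<in> pverts (grid_graph k s r)" and j: "j < k"
  shows "card (color_class (grid_graph k s r) color j \<inter> nbhd (grid_graph k s r) v)
    = (if v \<in> color_class (grid_graph k s r) color j then s else r)"
proof -
  let ?N = "color_class (grid_graph k s r) color j \<inter> nbhd (grid_graph k s r) v"
  obtain i x y where v_eq: "v = enc (i, x, y)"
    and mem: "i < k" "x \<le> s" "y < max 1 r"
    using v by (auto simp: grid_vertices_def)
  have "?N = enc ` {w \<in> grid_vertices k s r. fst w = j \<and> grid_adj r (i, x, y) w}"
    using v unfolding v_eq by (auto simp: color_class_def nbhd_def)
  then have N: "card ?N = card {w \<in> grid_vertices k s r. fst w = j \<and> grid_adj r (i, x, y) w}"
    by simp
  have "v \<in> color_class (grid_graph k s r) color j \<longleftrightarrow> i = j"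
    using v unfolding v_eq by (auto simp: color_class_def)
  moreover have "card ?N = s" if "i = j"
  proof -
    have "{w \<in> grid_vertices k s r. fst w = j \<and> grid_adj r (i, x, y) w}
        = {j} \<times> ({..s} - {x}) \<times> {y}"
      using that mem by (auto simp: grid_vertices_def)
    then show ?thesis
      using mem by (simp add: N card_cartesian_product)
  qed
  moreover have "card ?N = r" if "i \<noteq> j"
  proof -
    \<comment> \<open>This covers \<open>r = 0\<close> too: the single layer then has no arcs to
      other classes, and \<open>{..<r}\<close> is empty.\<close>
    have "{w \<in> grid_vertices k s r. fst w = j \<and> grid_adj r (i, x, y) w} = {j} \<times> {x} \<times> {..<r}"
      using that mem j by (auto simp: grid_vertices_def)
    then show ?thesis
      by (simp add: N card_cartesian_product)
  qed
  ultimately show ?thesis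
    by simp
qed

lemma color_grid_graph_subset: "color ` pverts (grid_graph k s r) \<subseteq> {..<k}"
  by (auto simp: grid_vertices_def)

lemma deg_grid_graph:
  assumes v: "v \<in> pverts (grid_graph k s r)"
  shows "deg (grid_graph k s r) v = s + (k - 1) * r"
proof -
  have c: "color v \<in> {..<k}"
    using v color_grid_graph_subset by blast
  have "deg (grid_graph k s r) v
      = (\<Sum>j<k. card (color_class (grid_graph k s r) color j \<inter> nbhd (grid_graph k s r) v))"
    by (rule deg_eq_sum_color_classes)
      (use color_grid_graph_subset in \<open>auto simp: pair_graph_grid_graph\<close>)
  also have "\<dots> = (\<Sum>j<k. if j = color v then s else r)"
    by (intro sum.cong refl, subst card_color_class_nbhd_grid_graph)
      (use v in \<open>auto simp: color_class_def\<close>)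
  also have "\<dots> = s + (\<Sum>j\<in>{..<k} - {color v}. r)"
    using c by (subst sum.remove[of _ "color v"]) auto
  also have "\<dots> = s + (k - 1) * r"
    using c by simp
  finally show ?thesis .
qed

lemma FAT_coloring_grid_graph:
  assumes "\<alpha> \<in> {0..1}" "\<beta> \<in> {0..1}"
    and "\<alpha> * real (s + (k - 1) * r) = real r" "\<beta> * real (s + (k - 1) * r) = real s"
  shows "FAT_coloring (grid_graph k s r) k \<alpha> \<beta> {..<k} color"
  unfolding FAT_coloring_def
proof (intro conjI ballI)
  fix i assume "i \<in> {..<k}"
  then have "enc (i, 0, 0) \<in> color_class (grid_graph k s r) color i"
    by (auto simp: color_class_def grid_vertices_def)
  then show "color_class (grid_graph k s r) color i \<noteq> {}"
    by blast
qed (use assms color_grid_graph_subset in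
  \<open>simp_all add: card_color_class_nbhd_grid_graph deg_grid_graph del: pverts_grid_graph\<close>)

lemma no_hom_grid_graph:
  assumes "k > 0" and lt: "s' + (k' - 1) * r' < s"
  shows "\<not> graph_hom (grid_graph k s r) (grid_graph k' s' r') f"
proof
  assume f: "graph_hom (grid_graph k s r) (grid_graph k' s' r') f"
  \<comment> \<open>One of the cliques inside color class 0; layer 0 exists even when
    \<open>r = 0\<close>.\<close>
  let ?K = "enc ` ({0} \<times> {..s} \<times> {0})" and ?v = "enc (0, 0, 0)"
  have sub: "?K \<subseteq> pverts (grid_graph k s r)"
    using \<open>k > 0\<close> by (auto simp: grid_vertices_def)
  have "Suc s = card ?K"
    by (simp add: card_cartesian_product)
  also have "\<dots> \<le> Suc (deg (grid_graph k' s' r') (f ?v))"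
    using f pair_graph_grid_graph
  proof (rule clique_card_le_deg)
    fix u v assume "u \<in> ?K" "v \<in> ?K" "u \<noteq> v"
    then obtain x y where "u = enc (0, x, 0)" "v = enc (0, y, 0)" "x \<noteq> y"
      by auto
    then show "(u, v) \<in> parcs (grid_graph k s r)"
      using \<open>u \<in> ?K\<close> \<open>v \<in> ?K\<close> sub by auto
  qed (use sub in auto)
  also have "deg (grid_graph k' s' r') (f ?v) = s' + (k' - 1) * r'"
    using f sub by (intro deg_grid_graph) (auto simp: graph_hom_def simp del: pverts_grid_graph)
  finally show False
    using lt by linarith
qed

theorem theorem2p1:
  fixes k :: nat and \<alpha> \<beta> :: real
  assumes "k > 1"
    and "\<alpha> \<in> {0..<1 / (real k - 1)} \<inter> \<rat>"
    and "\<beta> \<in> {0..1} \<inter> \<rat>"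
    and "\<beta> + (real k - 1) * \<alpha> = 1"
  shows "\<exists>G :: nat \<Rightarrow> nat pair_pre_digraph.
    (\<forall>n\<ge>1. simple_graph (G n) \<and> regular_graph (G n) \<and>
       (\<forall>v \<in> pverts (G n). deg (G n) v > 0) \<and>
       admits_FAT_coloring (G n) k \<alpha> \<beta>) \<and>
    (\<forall>i\<ge>1. \<forall>j\<ge>1. i \<noteq> j \<longrightarrow> \<not> hom_equivalent (G i) (G j))"
proof -
  have \<alpha>_lt: "\<alpha> * real (k - 1) < 1"
    using assms(1,2) by (simp add: pos_less_divide_eq of_nat_diff)
  have "\<bar>\<alpha>\<bar> = \<alpha>"
    using assms(2) by simp
  then obtain a d :: nat where d: "d \<noteq> 0" and \<alpha>: "\<alpha> = real a / real d"
    using assms(2) by (metis IntD2 Rats_abs_nat_div_natE)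
  have "real ((k - 1) * a) < real d"
    using \<alpha>_lt d by (simp add: \<alpha> pos_divide_less_eq mult.commute)
  then have lt: "(k - 1) * a < d"
    by (simp only: of_nat_less_iff)
  \<comment> \<open>The subtraction is not truncated, by \<open>lt\<close>. The relation between
    \<alpha> and \<beta> forces \<beta> = b / d, with the same denominator as \<alpha>.\<close>
  define b where "b = d - (k - 1) * a"
  have b: "b > 0" and d_eq: "b + (k - 1) * a = d"
    using lt by (auto simp: b_def)
  have "real b = real d - (real k - 1) * real a"
    using assms(1) arg_cong[OF d_eq, of real] by (simp add: of_nat_diff)
  then have "real b / real d = 1 - (real k - 1) * \<alpha>"
    using d by (simp add: \<alpha> diff_divide_distrib)
  then have \<beta>: "\<beta> = real b / real d"
    using assms(4) by simp
  have \<alpha>01: "\<alpha> \<in> {0..1}"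
  proof -
    \<comment> \<open>Here k - 1 is at least 1 and \<alpha> is nonnegative.\<close>
    have "\<alpha> * 1 \<le> \<alpha> * real (k - 1)"
      using assms(1,2) by (intro mult_left_mono) auto
    then show ?thesis
      using \<alpha>_lt assms(2) by simp
  qed
  define t where "t n = (d + 1) ^ n" for n :: nat
  have t_pos: "t n > 0" for n
    by (simp add: t_def)
  have degree: "b * t n + (k - 1) * (a * t n) = d * t n" for n
    using arg_cong[OF d_eq, of "\<lambda>m. m * t n"] by (simp add: distrib_right mult.assoc)
  define G where "G n = grid_graph k (b * t n) (a * t n)" for n
  have deg_G: "deg (G n) v = d * t n" if "v \<in> pverts (G n)" for n v
    using that unfolding G_def degree[symmetric] by (rule deg_grid_graph)
  have fat: "FAT_coloring (G n) k \<alpha> \<beta> {..<k} color" for n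
    unfolding G_def
  proof (rule FAT_coloring_grid_graph)
    show "\<alpha> * real (b * t n + (k - 1) * (a * t n)) = real (a * t n)"
      unfolding degree using d by (simp add: \<alpha>)
    show "\<beta> * real (b * t n + (k - 1) * (a * t n)) = real (b * t n)"
      unfolding degree using d by (simp add: \<beta>)
  qed (use assms(3) \<alpha>01 in auto)
  \<comment> \<open>Excluding maps from the larger index to the smaller suffices, because
    equivalence asks for both directions.\<close>
  have no_hom: "\<not> graph_hom (G j) (G i) f" if "i < j" for i j f
  proof -
    have "b * t i + (k - 1) * (a * t i) = d * t i"
      by (rule degree)
    also have "\<dots> < t (Suc i)"
      using t_pos[of i] by (simp add: t_def)
    also have "\<dots> \<le> t j"
      using that unfolding t_def by (intro power_increasing) auto
    \<comment> \<open>The strict bound on \<alpha> enters through b > 0: it makes the cliques inside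
      a class grow with \<open>t j\<close>.\<close>
    also have "\<dots> \<le> b * t j"
      using b by simp
    finally show ?thesis
      unfolding G_def using assms(1) by (intro no_hom_grid_graph) auto
  qed
  have not_equiv: "\<not> hom_equivalent (G i) (G j)" if "i \<noteq> j" for i j
    using no_hom[of i j] no_hom[of j i] that by (cases "i < j") (auto simp: hom_equivalent_def)
  have simple: "simple_graph (G n)" for n
    unfolding G_def using assms(1) by (intro simple_graph_grid_graph) simp
  have "regular_graph (G n)" for n
    by (simp add: regular_graph_def deg_G)
  moreover have "\<forall>v \<in> pverts (G n). deg (G n) v > 0" for n
    using d t_pos[of n] by (simp add: deg_G)
  moreover have "admits_FAT_coloring (G n) k \<alpha> \<beta>" for n
    unfolding admits_FAT_coloring_def using fat[of n] by (intro exI)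
  ultimately show ?thesis
    using simple not_equiv by (intro exI[of _ G] conjI allI impI)
qed

end
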